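(* Let $\Omega$ be a connected bounded domain in $\mathbb{R}^{d}$ with $C^{1}$ boundary, and let $F, G:\bar\Omega\to\mathbb{R}^{d}$ be $C^{1}(\bar\Omega)$ mappings such that $F=G$ on $\partial\Omega$. Then $$\int_{\Omega}\det DF\,dx=\int_{\Omega}\det DG\,dx.$$
   Context: $\mathbb{R}^{d}$ is the Euclidean space of points $x=(x^{1},\dots,x^{d})$. A domain is an open set; $\bar\Omega$ and $\partial\Omega$ denote its closure and boundary. $C^{1}(\bar\Omega)$ is used in the standard sense: the mapping is continuous on $\bar\Omega$, continuously differentiable in $\Omega$, and its first-order partial derivatives extend continuously to $\bar\Omega$. For a mapping $F=(F^{1},\dots,F^{d})$ with values in $\mathbb{R}^{d}$, $DF$ denotes the Jacobian matrix $DF=(a^{ij})_{i,j=1}^{d}$ with $a^{ij}=D_{j}F^{i}=\partial F^{i}/\partial x^{j}$. Integrals are with respect to Lebesgue measure. *)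

theory Defs
  imports "HOL-Analysis.Analysis"
begin

text \<open>Meant for open \<open>S\<close>; the derivative is continuous with respect to the operator norm.\<close>

definition C1_on :: "'a::real_normed_vector set \<Rightarrow> ('a \<Rightarrow> 'b::real_normed_vector) \<Rightarrow> bool" where
  "C1_on S f \<longleftrightarrow>
     (\<exists>f' :: 'a \<Rightarrow> 'a \<Rightarrow>\<^sub>L 'b.
        (\<forall>x\<in>S. (f has_derivative blinfun_apply (f' x)) (at x)) \<and> continuous_on S f')"

text \<open>
  The class \<open>C\<^sup>1\<close> on the closure of an open set \<open>S\<close>. The \<open>(i, j)\<close> entry of
  \<open>jacobian F (at x)\<close> is the partial derivative of the \<open>i\<close>-th component of \<open>F\<close> in the
  \<open>j\<close>-th coordinate direction; on an open \<open>S\<close> it does not depend on the values of \<open>F\<close>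
  outside \<open>S\<close>.
\<close>

definition C1_closure :: "(real ^ 'n) set \<Rightarrow> (real ^ 'n \<Rightarrow> real ^ 'm) \<Rightarrow> bool" where
  "C1_closure S F \<longleftrightarrow>
     continuous_on (closure S) F \<and> C1_on S F \<and>
     (\<forall>i j. \<exists>g :: real ^ 'n \<Rightarrow> real.
        continuous_on (closure S) g \<and> (\<forall>x\<in>S. g x = jacobian F (at x) $ i $ j))"

text \<open>
  Near each boundary point, in suitable rectangular coordinates, \<open>S\<close> is the part of a ball
  lying above the graph of a \<open>C\<^sup>1\<close> function of the first \<open>d - 1\<close> coordinates. The unit vector
  \<open>e\<close> is the last coordinate direction, and \<open>x - (x \<bullet> e) *\<^sub>R e\<close>, the orthogonal projection
  of \<open>x\<close> to the hyperplane orthogonal to \<open>e\<close>, stands for the other \<open>d - 1\<close> coordinates;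
  \<open>\<gamma>\<close> is only ever evaluated on that hyperplane.
\<close>

definition C1_boundary :: "(real ^ 'n) set \<Rightarrow> bool" where
  "C1_boundary S \<longleftrightarrow>
     (\<forall>p\<in>frontier S. \<exists>r>0. \<exists>e. \<exists>\<gamma> :: real ^ 'n \<Rightarrow> real.
        norm e = 1 \<and> C1_on UNIV \<gamma> \<and>
        S \<inter> ball p r = {x \<in> ball p r. x \<bullet> e > \<gamma> (x - (x \<bullet> e) *\<^sub>R e)})"

end

theory Submission
  imports Defs
begin

text \<open>
  Put \<open>u = F - G\<close>, which vanishes on the boundary, so each superlevel set
  \<open>{\<bar>u\<bar>\<^sup>2 \<ge> \<epsilon>}\<close> is a compact subset of \<open>\<Omega>\<close>.

  For a \<open>C\<^sup>1\<close> map \<open>\<Phi>\<close> of compact support and small \<open>t\<close>, the map \<open>x + t \<Phi>(x)\<close> is a bijection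
  that is the identity outside a box, so \<open>\<integral> det (1 + t D\<Phi>)\<close> over the box is its volume; the left
  side is a polynomial in \<open>t\<close>, and its leading coefficient gives \<open>\<integral> det D\<Phi> = 0\<close>.
  With cut-off functions \<open>\<chi>\<^sub>1\<close>, \<open>\<chi>\<^sub>2\<close> of \<open>\<bar>u\<bar>\<^sup>2\<close> such that \<open>\<chi>\<^sub>1 = 1\<close> on the support of
  \<open>\<chi>\<^sub>2\<close>, this applies to \<open>\<chi>\<^sub>1 G + \<chi>\<^sub>2 u\<close> and to \<open>\<chi>\<^sub>1 G\<close>, and the difference of the two
  determinants is \<open>det D(G + \<chi>\<^sub>2 u) - det DG\<close> everywhere.
  As the cut-off level tends to \<open>0\<close>, \<open>D(\<chi>\<^sub>2 u)\<close> stays bounded and converges to \<open>Du\<close> off the set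
  where \<open>u = 0\<close> but \<open>Du \<noteq> 0\<close>, which is a null set by the inverse function theorem.
\<close>


section \<open>Jacobian determinants of compactly supported maps\<close>

text \<open>Expand each product in the Leibniz formula by the set \<open>X\<close> of rows in which
  the entry of \<open>t *\<^sub>R A\<close> is chosen. Sets with \<open>k\<close> elements make up
  the coefficient of \<open>t ^ k\<close>, and for \<open>k = CARD('n)\<close> only
  \<open>X = UNIV\<close> remains. Continuity of the coefficients serves to integrate them termwise
  later.\<close>

lemma det_mat_1_plus_scaleR:
  obtains c :: "nat \<Rightarrow> real^'n^'n \<Rightarrow> real" where
    "\<And>A t. det (mat 1 + t *\<^sub>R A) = (\<Sum>k\<le>CARD('n). c k A * t ^ k)"
    "\<And>A. c (CARD('n)) A = det A"
    "\<And>k. continuous_on UNIV (c k)"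
proof -
  define f :: "('n \<Rightarrow> 'n) \<Rightarrow> 'n set \<Rightarrow> real^'n^'n \<Rightarrow> real" where
    "f p X A = (\<Prod>i\<in>X. A $ i $ p i) * (\<Prod>i\<in>-X. mat 1 $ i $ p i)" for p X A
  define c where
    "c k A = (\<Sum>p | p permutes (UNIV :: 'n set). of_int (sign p) * (\<Sum>X | card X = k. f p X A))"
    for k A
  show ?thesis
  proof
    show "det (mat 1 + t *\<^sub>R A) = (\<Sum>k\<le>CARD('n). c k A * t ^ k)" for A t
    proof -
      have *: "(\<Prod>i\<in>UNIV. t * A $ i $ p i + mat 1 $ i $ p i)
          = (\<Sum>k\<le>CARD('n). (\<Sum>X | card X = k. f p X A) * t ^ k)" for p :: "'n \<Rightarrow> 'n"
      proof -
        have "(\<Prod>i\<in>UNIV. t * A $ i $ p i + mat 1 $ i $ p i) = (\<Sum>X\<in>UNIV. f p X A * t ^ card X)"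
          by (subst prod_add)
            (simp_all add: f_def prod.distrib mult_ac Compl_eq_Diff_UNIV)
        also have "\<dots> = (\<Sum>k\<le>CARD('n). \<Sum>X | X \<in> UNIV \<and> card X = k. f p X A * t ^ card X)"
          by (rule sum.group[symmetric]) (auto intro: card_mono)
        finally show ?thesis
          by (simp add: sum_distrib_right)
      qed
      have "det (mat 1 + t *\<^sub>R A)
          = (\<Sum>p | p permutes (UNIV :: 'n set). of_int (sign p) * (\<Prod>i\<in>UNIV. t * A $ i $ p i + mat 1 $ i $ p i))"
        by (simp add: det_def add.commute)
      also have "\<dots> = (\<Sum>k\<le>CARD('n). c k A * t ^ k)"
        unfolding * c_def sum_distrib_right sum_distrib_left
        by (subst sum.swap) (simp add: mult_ac)
      finally show ?thesis .
    qed
    show "c (CARD('n)) A = det A" for A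
    proof -
      have "X = UNIV" if "card X = CARD('n)" for X :: "'n set"
        using that by (intro card_subset_eq) simp_all
      then have "{X :: 'n set. card X = CARD('n)} = {UNIV}"
        by auto
      then show ?thesis
        by (simp add: c_def f_def det_def)
    qed
    show "continuous_on UNIV (c k)" for k
      unfolding c_def f_def by (intro continuous_intros)
  qed
qed

lemma continuous_on_det [continuous_intros]:
  fixes A :: "'a::topological_space \<Rightarrow> real^'n^'n"
  assumes "continuous_on S A"
  shows "continuous_on S (\<lambda>x. det (A x))"
  unfolding det_def by (intro continuous_intros assms)

lemma matrix_eq_0_if_locally_zero:
  fixes \<Phi> :: "real^'n \<Rightarrow> real^'m"
  assumes "(\<Phi> has_derivative (\<lambda>h. A *v h)) (at x)" "open S" "x \<in> S" "\<And>y. y \<in> S \<Longrightarrow> \<Phi> y = 0"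
  shows "A = 0"
proof -
  have "(\<Phi> has_derivative (\<lambda>h. 0)) (at x)"
    by (rule has_derivative_transform_within_open[of "\<lambda>_. 0" _ _ _ S]) (use assms in auto)
  then have "(*v) A = (\<lambda>h. 0)"
    using assms(1) has_derivative_unique by blast
  then show ?thesis
    by (metis matrix_eq matrix_vector_mult_0)
qed

text \<open>Along the segment from \<open>mat 1\<close> the determinant starts at 1 and cannot
  vanish: a kernel vector \<open>h\<close> would satisfy \<open>norm h = s * norm (A *v h)\<close>,
  which is less than \<open>norm h\<close> for \<open>h \<noteq> 0\<close>. The sign allows the
  absolute value in the change of variables formula to be dropped.\<close>

lemma det_mat_1_plus_pos:
  fixes A :: "real^'n^'n"
  assumes "0 \<le> t" "t * L < 1" "\<And>h. norm (A *v h) \<le> L * norm h"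
  shows "0 < det (mat 1 + t *\<^sub>R A)"
proof -
  have nz: "det (mat 1 + s *\<^sub>R A) \<noteq> 0" if s: "0 \<le> s" "s \<le> t" for s
  proof -
    have "h = 0" if h: "(mat 1 + s *\<^sub>R A) *v h = 0" for h
    proof (rule ccontr)
      assume "h \<noteq> 0"
      have "h = - (s *\<^sub>R (A *v h))"
        using h by (simp add: matrix_vector_mult_add_rdistrib scaleR_matrix_vector_assoc eq_neg_iff_add_eq_0)
      then have "norm h = s * norm (A *v h)"
        using s by (metis norm_minus_cancel norm_scaleR abs_of_nonneg)
      also have "\<dots> \<le> t * (L * norm h)"
        using s assms by (intro mult_mono) auto
      also have "\<dots> < norm h"
        using assms(2) \<open>h \<noteq> 0\<close> by (simp flip: mult.assoc)
      finally show False by simp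
    qed
    then show ?thesis
      by (metis invertible_det_nz invertible_left_inverse matrix_left_invertible_ker)
  qed
  show ?thesis
  proof (rule ccontr)
    assume "\<not> ?thesis"
    then have "\<exists>s\<ge>0. s \<le> t \<and> det (mat 1 + s *\<^sub>R A) = 0"
      using assms(1) by (intro IVT2') (auto intro!: continuous_intros)
    then show False using nz by blast
  qed
qed

text \<open>Since \<open>t * L < 1\<close>, the map \<open>t *\<^sub>R \<Phi> x\<close> is a
  contraction, so its sum \<open>T\<close> with the identity is a bijection of the whole space. It
  fixes every point outside \<open>S\<close>, hence maps \<open>S\<close> onto itself, and the
  change of variables formula for \<open>T\<close> on \<open>S\<close> is the claim.\<close>

lemma has_integral_det_perturbed_identity:
  fixes \<Phi> :: "real^'n::{finite,wellorder} \<Rightarrow> real^'n::_" and A :: "real^'n::_ \<Rightarrow> real^'n::_^'n::_"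
  assumes deriv: "\<And>x. (\<Phi> has_derivative (\<lambda>h. A x *v h)) (at x)"
    and bound: "\<And>x h. norm (A x *v h) \<le> L * norm h"
    and supp: "\<And>x. x \<notin> S \<Longrightarrow> \<Phi> x = 0"
    and S: "S \<in> lmeasurable"
    and t: "0 \<le> t" "t * L < 1"
  shows "((\<lambda>x. det (mat 1 + t *\<^sub>R A x)) has_integral measure lebesgue S) S"
proof -
  define T where "T x = x + t *\<^sub>R \<Phi> x" for x
  have "0 \<le> L"
  proof -
    have "0 \<le> L * norm (axis undefined 1 :: real^'n::_)"
      using bound norm_ge_zero order_trans by blast
    then show ?thesis by simp
  qed
  have lip: "norm (\<Phi> x - \<Phi> y) \<le> L * norm (x - y)" for x y
  proof (rule differentiable_bound[where S = UNIV and f' = "\<lambda>x h. A x *v h"])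
    show "onorm (\<lambda>h. A z *v h) \<le> L" for z
      by (rule onorm_le) (rule bound)
  qed (simp_all add: deriv)
  have dist: "dist (t *\<^sub>R \<Phi> x) (t *\<^sub>R \<Phi> y) \<le> (t * L) * dist x y" for x y
  proof -
    have "dist (t *\<^sub>R \<Phi> x) (t *\<^sub>R \<Phi> y) = t * norm (\<Phi> x - \<Phi> y)"
      using t(1) by (simp add: dist_norm flip: scaleR_diff_right)
    also have "\<dots> \<le> t * (L * norm (x - y))"
      using lip t(1) by (rule mult_left_mono)
    finally show ?thesis by (simp add: dist_norm mult.assoc)
  qed
  have inj: "inj T"
  proof (rule injI, rule ccontr)
    fix x y assume xy: "T x = T y" "x \<noteq> y"
    then have "dist x y = dist (t *\<^sub>R \<Phi> x) (t *\<^sub>R \<Phi> y)"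
    proof -
      have "x - y = (T x - T y) - (t *\<^sub>R \<Phi> x - t *\<^sub>R \<Phi> y)"
        by (simp add: T_def)
      then show ?thesis
        using xy by (simp add: dist_norm norm_minus_commute)
    qed
    also have "\<dots> < dist x y"
      using dist[of x y] t(2) xy(2) by (smt (verit) mult_less_cancel_right2 zero_less_dist_iff)
    finally show False by simp
  qed
  \<comment> \<open>A solution of \<open>T x = y\<close> is a fixed point of the contraction taking
    \<open>x\<close> to \<open>y - t *\<^sub>R \<Phi> x\<close>.\<close>
  have surj: "\<exists>x. T x = y" for y
  proof -
    have "dist (y - t *\<^sub>R \<Phi> x) (y - t *\<^sub>R \<Phi> z) = dist (t *\<^sub>R \<Phi> x) (t *\<^sub>R \<Phi> z)" for x z
      by (simp add: dist_norm norm_minus_commute)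
    then have "\<exists>!x. y - t *\<^sub>R \<Phi> x = x"
      using t \<open>0 \<le> L\<close> dist by (intro banach_fix_type[of "t * L"]) simp_all
    then show ?thesis unfolding T_def by (metis diff_add_cancel)
  qed
  have fix_T: "T x = x" if "x \<notin> S" for x
    by (simp add: T_def supp that)
  have "T ` S = S"
  proof
    show "T ` S \<subseteq> S"
    proof (rule image_subsetI, rule ccontr)
      \<comment> \<open>A point \<open>T x\<close> outside \<open>S\<close> is fixed by
        \<open>T\<close>, so injectivity gives \<open>T x = x\<close>, which lies in
        \<open>S\<close>.\<close>
      fix x assume "x \<in> S" "T x \<notin> S"
      then show False
        using fix_T[of "T x"] injD[OF inj, of "T x" x] by simp
    qed
    show "S \<subseteq> T ` S"
    proof
      fix y assume "y \<in> S"
      obtain x where "T x = y" using surj by blast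
      then show "y \<in> T ` S"
        using fix_T[of x] \<open>y \<in> S\<close> by (cases "x \<in> S") auto
    qed
  qed
  have "((\<lambda>x. \<bar>det (matrix (\<lambda>h. h + t *\<^sub>R (A x *v h)))\<bar>) has_integral measure lebesgue S) S"
  proof (rule iffD1[OF has_measure_differentiable_image[of S T]])
    show "inj_on T S" using inj by (rule inj_on_subset) auto
    show "(T has_derivative (\<lambda>h. h + t *\<^sub>R (A x *v h))) (at x within S)" for x
      unfolding T_def
      by (intro has_derivative_add has_derivative_ident has_derivative_scaleR_right
          has_derivative_at_withinI[OF deriv])
    show "T ` S \<in> lmeasurable \<and> measure lebesgue (T ` S) = measure lebesgue S"
      using S \<open>T ` S = S\<close> by simp
    show "S \<in> sets lebesgue" using S by blast
  qed
  moreover have "matrix (\<lambda>h. h + t *\<^sub>R (A x *v h)) = mat 1 + t *\<^sub>R A x" for x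
  proof -
    have "(\<lambda>h. h + t *\<^sub>R (A x *v h)) = (*v) (mat 1 + t *\<^sub>R A x)"
      by (simp add: fun_eq_iff matrix_vector_mult_add_rdistrib scaleR_matrix_vector_assoc)
    then show ?thesis by simp
  qed
  moreover have "\<bar>det (mat 1 + t *\<^sub>R A x)\<bar> = det (mat 1 + t *\<^sub>R A x)" for x
    by (intro abs_of_pos det_mat_1_plus_pos[OF t]) (rule bound)
  ultimately show ?thesis by simp
qed

text \<open>For \<open>0 < t < 1 / L\<close> the integral of
  \<open>det (mat 1 + t *\<^sub>R A x)\<close> is the volume \<open>m\<close> of the box, and it is
  also a polynomial in \<open>t\<close> whose top coefficient is the integral of
  \<open>det (A x)\<close>. A polynomial that is constant on an interval has no terms of positive
  degree.\<close>

lemma has_integral_det_compact_support_wellorder: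
  fixes \<Phi> :: "real^'n::{finite,wellorder} \<Rightarrow> real^'n::_" and A :: "real^'n::_ \<Rightarrow> real^'n::_^'n::_"
  assumes deriv: "\<And>x. (\<Phi> has_derivative (\<lambda>h. A x *v h)) (at x)"
    and cont: "continuous_on UNIV A"
    and supp: "\<And>x. x \<notin> cbox a b \<Longrightarrow> \<Phi> x = 0"
  shows "((\<lambda>x. det (A x)) has_integral 0) (cbox a b)"
proof -
  \<comment> \<open>With \<open>A\<close> zero off the box, a bound on the compact box is a bound
    everywhere, which gives a global Lipschitz constant \<open>L\<close>.\<close>
  have A0: "A x = 0" if "x \<notin> cbox a b" for x
    by (rule matrix_eq_0_if_locally_zero[OF deriv, of "- cbox a b"])
      (use that supp in \<open>auto simp: open_Compl closed_cbox\<close>)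
  obtain C where "C > 0" and C: "\<And>x. x \<in> cbox a b \<Longrightarrow> norm (A x) \<le> C"
    using compact_continuous_image[OF continuous_on_subset[OF cont] compact_cbox, of a b]
    by (force dest!: compact_imp_bounded simp: bounded_pos)
  have "norm (A x) \<le> C" for x
    using A0 C \<open>C > 0\<close> by (cases "x \<in> cbox a b") auto
  then have "\<bar>A x $ i $ j\<bar> \<le> C" for x i j
    using component_le_norm_cart[of "A x $ i" j] Finite_Cartesian_Product.norm_nth_le[of "A x" i]
    by (smt (verit))
  then have on: "onorm ((*v) (A x)) \<le> real CARD('n) * real CARD('n) * C" for x
    by (rule onorm_le_matrix_component)
  define L where "L = real CARD('n) * real CARD('n) * C"
  have "L > 0" using \<open>C > 0\<close> by (simp add: L_def)
  have bound: "norm (A x *v h) \<le> L * norm h" for x h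
  proof -
    have "norm (A x *v h) \<le> onorm ((*v) (A x)) * norm h"
      by (rule onorm) (rule matrix_vector_mul_bounded_linear)
    also have "\<dots> \<le> L * norm h"
      using on unfolding L_def by (rule mult_right_mono) simp
    finally show ?thesis .
  qed
  obtain c :: "nat \<Rightarrow> real^'n::_^'n::_ \<Rightarrow> real" where
    c: "\<And>A t. det (mat 1 + t *\<^sub>R A) = (\<Sum>k\<le>CARD('n). c k A * t ^ k)"
    "\<And>A. c (CARD('n)) A = det A" "\<And>k. continuous_on UNIV (c k)"
    by (rule det_mat_1_plus_scaleR) (rule that)
  have int: "(\<lambda>x. c k (A x)) integrable_on cbox a b" for k
  proof (rule integrable_continuous)
    have "continuous_on UNIV (\<lambda>x. c k (A x))"
      by (rule continuous_on_compose2[OF c(3) cont]) simp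
    then show "continuous_on (cbox a b) (\<lambda>x. c k (A x))"
      by (rule continuous_on_subset) simp
  qed
  define J where "J k = integral (cbox a b) (\<lambda>x. c k (A x))" for k
  define m where "m = measure lebesgue (cbox a b)"
  have root: "(\<Sum>k\<le>CARD('n). (J k - (if k = 0 then m else 0)) * t ^ k) = 0" if t: "0 < t" "t < 1 / L" for t
  proof -
    have "((\<lambda>x. det (mat 1 + t *\<^sub>R A x)) has_integral m) (cbox a b)"
      unfolding m_def using t \<open>L > 0\<close>
      by (intro has_integral_det_perturbed_identity[OF deriv bound supp]) (auto simp: field_simps)
    moreover have "((\<lambda>x. det (mat 1 + t *\<^sub>R A x)) has_integral (\<Sum>k\<le>CARD('n). J k * t ^ k)) (cbox a b)"
      unfolding c(1) J_def
      by (intro has_integral_sum has_integral_mult_left[OF integrable_integral] int finite_atMost)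
    ultimately have "(\<Sum>k\<le>CARD('n). J k * t ^ k) = m"
      using has_integral_unique by blast
    moreover have "(\<Sum>k\<le>CARD('n). (if k = 0 then m else 0) * t ^ k) = m"
      by (simp add: sum.atMost_shift)
    ultimately show ?thesis
      by (simp add: left_diff_distrib sum_subtractf)
  qed
  have "\<not> finite {t. (\<Sum>k\<le>CARD('n). (J k - (if k = 0 then m else 0)) * t ^ k) = 0}"
  proof
    assume "finite {t. (\<Sum>k\<le>CARD('n). (J k - (if k = 0 then m else 0)) * t ^ k) = 0}"
    then have "finite {0<..<1 / L}"
      by (rule finite_subset[rotated]) (use root in auto)
    then show False using \<open>L > 0\<close> by (simp add: infinite_Ioo)
  qed
  \<comment> \<open>The dimension is positive, so subtracting \<open>m\<close> from the constant
    term leaves the top coefficient as it was.\<close>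
  then have "J (CARD('n)) - (if CARD('n) = 0 then m else 0) = 0"
    unfolding polyfun_finite_roots by auto
  then have "J (CARD('n)) = 0" by simp
  then show ?thesis
    using int[of "CARD('n)"] by (simp add: J_def c(2) has_integral_iff)
qed

text \<open>
  The change of variables theorem of the library requires a well-ordered index type; an
  arbitrary finite index type is reduced to that case by a copy with an order.
\<close>

typedef 'a wellordered = "UNIV :: 'a set"
  morphisms of_wellordered to_wellordered ..

lemma bij_to_wellordered: "bij to_wellordered"
  by (metis UNIV_I bijI' of_wellordered_inverse to_wellordered_inject)

lemma to_wellordered_inverse' [simp]: "of_wellordered (to_wellordered x) = x"
  by (simp add: to_wellordered_inverse)

lemma UNIV_wellordered: "UNIV = to_wellordered ` UNIV"
  using bij_to_wellordered by (metis bij_is_surj)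

instance wellordered :: (finite) finite
  by standard (metis UNIV_wellordered finite finite_imageI)

instantiation wellordered :: (finite) wellorder
begin

definition less_eq_wellordered :: "'a wellordered \<Rightarrow> 'a wellordered \<Rightarrow> bool" where
  "x \<le> y \<longleftrightarrow> to_nat (of_wellordered x) \<le> to_nat (of_wellordered y)"

definition less_wellordered :: "'a wellordered \<Rightarrow> 'a wellordered \<Rightarrow> bool" where
  "x < y \<longleftrightarrow> to_nat (of_wellordered x) < to_nat (of_wellordered y)"

instance
proof
  fix x y :: "'a wellordered" and P
  show "x = y" if "x \<le> y" "y \<le> x"
    using that by (simp add: less_eq_wellordered_def of_wellordered_inject)
  show "P x" if step: "\<And>x. (\<And>y. y < x \<Longrightarrow> P y) \<Longrightarrow> P x"
    by (induction x rule: measure_induct_rule[of "\<lambda>x. to_nat (of_wellordered x)"])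
      (rule step, simp add: less_wellordered_def)
qed (simp_all add: less_eq_wellordered_def less_wellordered_def, linarith+)

end

text \<open>Conjugation by \<open>f\<close> is a sign-preserving bijection between the permutations
  of the two index types, so the Leibniz sums agree term by term.\<close>

lemma det_reindex:
  fixes A :: "real^'n^'n" and f :: "'m::finite \<Rightarrow> 'n"
  assumes "bij f"
  shows "det (\<chi> i j. A $ f i $ f j) = det A"
proof -
  have inj: "inj f" and surj: "f ` UNIV = UNIV"
    using assms by (auto simp: bij_def)
  define \<sigma> where "\<sigma> p x = f (p (inv f x))" for p x
  have \<sigma>: "\<sigma> p = map_permutation UNIV f p" if "p permutes UNIV" for p
    using surj by (simp add: \<sigma>_def map_permutation_def restrict_id_def fun_eq_iff)
  have "bij_betw \<sigma> {p. p permutes UNIV} {p. p permutes UNIV}"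
    using bij_betw_permutations[OF assms] by (simp add: \<sigma>_def[abs_def])
  then have "det A = (\<Sum>p | p permutes UNIV. of_int (sign (\<sigma> p)) * (\<Prod>i\<in>UNIV. A $ i $ \<sigma> p i))"
    unfolding det_def by (rule sum.reindex_bij_betw[symmetric])
  also have "\<dots> = (\<Sum>p | p permutes UNIV. of_int (sign p) * (\<Prod>i\<in>UNIV. A $ f i $ f (p i)))"
  proof (intro sum.cong refl)
    fix p :: "'m \<Rightarrow> 'm" assume "p \<in> {p. p permutes UNIV}"
    then have "sign (\<sigma> p) = sign p"
      by (simp add: \<sigma> sign_map_permutation inj)
    moreover have "(\<Prod>i\<in>UNIV. A $ i $ \<sigma> p i) = (\<Prod>i\<in>UNIV. A $ f i $ \<sigma> p (f i))"
      using assms by (rule prod.reindex_bij_betw[symmetric])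
    ultimately show "of_int (sign (\<sigma> p)) * (\<Prod>i\<in>UNIV. A $ i $ \<sigma> p i)
        = of_int (sign p) * (\<Prod>i\<in>UNIV. A $ f i $ f (p i))"
      by (simp add: \<sigma>_def inj)
  qed
  also have "\<dots> = det (\<chi> i j. A $ f i $ f j)"
    by (simp add: det_def)
  finally show ?thesis ..
qed

lemma image_cbox_reindex:
  fixes a b :: "real^'n" and f :: "'m::finite \<Rightarrow> 'n"
  assumes "bij f"
  shows "(\<lambda>x. \<chi> i. x $ f i) ` cbox a b = cbox (\<chi> i. a $ f i) (\<chi> i. b $ f i)"
proof
  show "(\<lambda>x. \<chi> i. x $ f i) ` cbox a b \<subseteq> cbox (\<chi> i. a $ f i) (\<chi> i. b $ f i)"
    by (auto simp: mem_box_cart)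
  show "cbox (\<chi> i. a $ f i) (\<chi> i. b $ f i) \<subseteq> (\<lambda>x. \<chi> i. x $ f i) ` cbox a b"
  proof
    fix y assume y: "y \<in> cbox (\<chi> i. a $ f i) (\<chi> i. b $ f i)"
    define x where "x = (\<chi> j. y $ inv f j)"
    have "x \<in> cbox a b"
      unfolding mem_box_cart
    proof
      fix j
      show "a $ j \<le> x $ j \<and> x $ j \<le> b $ j"
        using y[unfolded mem_box_cart, rule_format, of "inv f j"] bij_is_surj[OF assms]
        by (simp add: x_def surj_f_inv_f)
    qed
    moreover have "y = (\<chi> i. x $ f i)"
      using bij_is_inj[OF assms] by (simp add: x_def vec_eq_iff)
    ultimately show "y \<in> (\<lambda>x. \<chi> i. x $ f i) ` cbox a b" by blast
  qed
qed

lemma content_cbox_reindex: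
  fixes a b :: "real^'n" and f :: "'m::finite \<Rightarrow> 'n"
  assumes "bij f"
  shows "measure lborel (cbox (\<chi> i. a $ f i) (\<chi> i. b $ f i)) = measure lborel (cbox a b)"
proof -
  have "(\<Prod>i\<in>UNIV. b $ f i - a $ f i) = (\<Prod>j\<in>UNIV. b $ j - a $ j)"
    using assms by (rule prod.reindex_bij_betw)
  moreover have "cbox (\<chi> i. a $ f i) (\<chi> i. b $ f i) = {} \<longleftrightarrow> cbox a b = {}"
    by (simp flip: image_cbox_reindex[OF assms])
  ultimately show ?thesis
    by (simp add: content_cbox_if_cart)
qed

text \<open>The claim is transported along the relabelling \<open>\<sigma>\<close> of coordinates
  and its inverse \<open>\<tau>\<close>. The map \<sigma> \<circ> \<Phi> \<circ> \<tau> has the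
  relabelled Jacobian \<open>B y\<close> with the same determinant, and \<sigma> takes boxes to
  boxes of equal volume, so the substitution in the integral has factor 1.\<close>

lemma has_integral_det_compact_support_cbox:
  fixes \<Phi> :: "real^'n \<Rightarrow> real^'n" and A :: "real^'n \<Rightarrow> real^'n^'n"
  assumes deriv: "\<And>x. (\<Phi> has_derivative (\<lambda>h. A x *v h)) (at x)"
    and cont: "continuous_on UNIV A"
    and supp: "\<And>x. x \<notin> cbox a b \<Longrightarrow> \<Phi> x = 0"
  shows "((\<lambda>x. det (A x)) has_integral 0) (cbox a b)"
proof -
  let ?f = "to_wellordered :: 'n \<Rightarrow> 'n wellordered"
  let ?g = "of_wellordered :: 'n wellordered \<Rightarrow> 'n"
  define \<sigma> :: "real^'n \<Rightarrow> real^'n wellordered" where "\<sigma> x = (\<chi> i. x $ ?g i)" for x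
  define \<tau> :: "real^'n wellordered \<Rightarrow> real^'n" where "\<tau> y = (\<chi> i. y $ ?f i)" for y
  have f: "bij ?f" by (rule bij_to_wellordered)
  have g: "bij ?g"
    by (metis bijI' of_wellordered_inject to_wellordered_inverse')
  have \<tau>\<sigma>: "\<tau> (\<sigma> x) = x" and \<sigma>\<tau>: "\<sigma> (\<tau> y) = y" for x y
    by (simp_all add: \<sigma>_def \<tau>_def of_wellordered_inverse)
  have \<sigma>_lin: "bounded_linear \<sigma>" and \<tau>_lin: "bounded_linear \<tau>"
    by (auto intro!: linear_conv_bounded_linear[THEN iffD1] linearI simp: \<sigma>_def \<tau>_def vec_eq_iff)
  have \<sigma>_cbox: "\<sigma> ` cbox u v = cbox (\<sigma> u) (\<sigma> v)" for u v
    unfolding \<sigma>_def[abs_def] using g by (rule image_cbox_reindex)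
  have \<tau>_cbox: "\<tau> ` cbox u v = cbox (\<tau> u) (\<tau> v)" for u v
    unfolding \<tau>_def[abs_def] using f by (rule image_cbox_reindex)
  define B where "B y = (\<chi> i j. A (\<tau> y) $ ?g i $ ?g j)" for y
  have B: "B y *v h = \<sigma> (A (\<tau> y) *v \<tau> h)" for y h
  proof -
    have "(\<Sum>j\<in>UNIV. A (\<tau> y) $ i $ ?g j * h $ j) = (\<Sum>j\<in>UNIV. A (\<tau> y) $ i $ j * h $ ?f j)" for i
      using sum.reindex_bij_betw[OF g, of "\<lambda>j. A (\<tau> y) $ i $ j * h $ ?f j"]
      by (simp add: of_wellordered_inverse)
    then show ?thesis
      by (simp add: vec_eq_iff B_def \<sigma>_def \<tau>_def matrix_vector_mult_def)
  qed
  have "((\<lambda>y. det (B y)) has_integral 0) (cbox (\<sigma> a) (\<sigma> b))"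
  proof (rule has_integral_det_compact_support_wellorder)
    show "((\<lambda>y. \<sigma> (\<Phi> (\<tau> y))) has_derivative (\<lambda>h. B y *v h)) (at y)" for y
      unfolding B
      by (intro bounded_linear.has_derivative[OF \<sigma>_lin]
          has_derivative_compose[OF bounded_linear_imp_has_derivative[OF \<tau>_lin] deriv])
    have "continuous_on UNIV (\<lambda>y. A (\<tau> y))"
      by (rule continuous_on_compose2[OF cont linear_continuous_on[OF \<tau>_lin]]) simp
    then show "continuous_on UNIV B"
      unfolding B_def by (intro continuous_intros)
    show "\<sigma> (\<Phi> (\<tau> y)) = 0" if "y \<notin> cbox (\<sigma> a) (\<sigma> b)" for y
    proof -
      have "\<tau> y \<notin> cbox a b"
        using that \<sigma>\<tau> \<sigma>_cbox by (metis imageI)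
      then show ?thesis
        by (simp add: supp \<sigma>_def vec_eq_iff)
    qed
  qed
  moreover have "det (B y) = det (A (\<tau> y))" for y
    unfolding B_def using g by (rule det_reindex)
  ultimately have "((\<lambda>y. det (A (\<tau> y))) has_integral 0) (cbox (\<sigma> a) (\<sigma> b))"
    by simp
  then have "((\<lambda>x. det (A (\<tau> (\<sigma> x)))) has_integral (1 / 1) *\<^sub>R 0) (\<tau> ` cbox (\<sigma> a) (\<sigma> b))"
  proof (rule has_integral_twiddle[rotated -1])
    show "isCont \<sigma> x" for x
      using \<sigma>_lin by (rule linear_continuous_at)
    show "measure lborel (\<sigma> ` cbox u v) = 1 * measure lborel (cbox u v)" for u v
      unfolding \<sigma>_cbox using content_cbox_reindex[OF g] by (simp add: \<sigma>_def)
  qed (auto simp: \<tau>\<sigma> \<sigma>\<tau> \<sigma>_cbox \<tau>_cbox)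
  then show ?thesis
    by (simp add: \<tau>\<sigma> \<tau>_cbox)
qed

lemma det_zero_matrix [simp]: "det (0 :: real^'n^'n) = 0"
  by (rule det_zero_row(1)[of undefined]) (simp add: row_def vec_eq_iff)

text \<open>Extension by zero reduces this to maps on the whole space. The extension is continuously
  differentiable because the open sets \<open>S\<close> and \<open>- K\<close> cover the space and
  it vanishes on the second.\<close>

lemma has_integral_det_compact_support:
  fixes \<Phi> :: "real^'n \<Rightarrow> real^'n" and A :: "real^'n \<Rightarrow> real^'n^'n"
  assumes "open S" and K: "compact K" "K \<subseteq> S"
    and deriv: "\<And>x. x \<in> S \<Longrightarrow> (\<Phi> has_derivative (\<lambda>h. A x *v h)) (at x)"
    and cont: "continuous_on S A"
    and supp: "\<And>x. x \<in> S \<Longrightarrow> x \<notin> K \<Longrightarrow> \<Phi> x = 0"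
  shows "((\<lambda>x. det (A x)) has_integral 0) S"
proof -
  define \<Phi>0 where "\<Phi>0 x = (if x \<in> S then \<Phi> x else 0)" for x
  define A0 where "A0 x = (if x \<in> S then A x else 0)" for x
  have "open (- K)" using K by (simp add: compact_imp_closed open_Compl)
  have A0: "A0 x = 0" if "x \<notin> K" for x
  proof (cases "x \<in> S")
    case True
    have "A x = 0"
      by (rule matrix_eq_0_if_locally_zero[OF deriv, of x "S - K"])
        (use True that supp \<open>open S\<close> K compact_imp_closed in auto)
    then show ?thesis by (simp add: A0_def)
  qed (simp add: A0_def)
  have deriv0: "(\<Phi>0 has_derivative (\<lambda>h. A0 x *v h)) (at x)" for x
  proof (cases "x \<in> S")
    case True
    have "(\<Phi> has_derivative (\<lambda>h. A0 x *v h)) (at x)"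
      using deriv[OF True] True by (simp add: A0_def)
    then show ?thesis
      by (rule has_derivative_transform_within_open[OF _ \<open>open S\<close> True]) (simp add: \<Phi>0_def)
  next
    case False
    then have "x \<in> - K" using K by auto
    have "((\<lambda>_. 0) has_derivative (\<lambda>h. A0 x *v h)) (at x)"
      using False by (simp add: A0_def)
    then show ?thesis
      by (rule has_derivative_transform_within_open[OF _ \<open>open (- K)\<close> \<open>x \<in> - K\<close>])
        (simp add: \<Phi>0_def supp)
  qed
  have "continuous_on (S \<union> - K) A0"
  proof (rule continuous_on_open_Un)
    show "continuous_on S A0"
      using cont by (rule continuous_on_eq) (simp add: A0_def)
    show "continuous_on (- K) A0"
      by (rule continuous_on_eq[OF continuous_on_const[of _ 0]]) (simp add: A0)
  qed fact+
  moreover have "S \<union> - K = UNIV" using K by auto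
  ultimately have cont0: "continuous_on UNIV A0" by simp
  obtain a b where ab: "K \<subseteq> cbox a b"
    using bounded_subset_cbox_symmetric[OF compact_imp_bounded[OF K(1)]] by metis
  have "((\<lambda>x. det (A0 x)) has_integral 0) (cbox a b)"
    by (rule has_integral_det_compact_support_cbox[OF deriv0 cont0])
      (use ab supp in \<open>auto simp: \<Phi>0_def\<close>)
  moreover have "det (A0 x) = 0" if "x \<notin> cbox a b" for x
  proof -
    have "A0 x = 0" using that ab by (intro A0) blast
    then show ?thesis by simp
  qed
  ultimately have "((\<lambda>x. det (A0 x)) has_integral 0) UNIV"
    by (rule has_integral_on_superset) auto
  also have "(\<lambda>x. det (A0 x)) = (\<lambda>x. if x \<in> S then det (A x) else 0)"
    by (auto simp: A0_def)
  finally show ?thesis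
    unfolding has_integral_restrict_UNIV .
qed

section \<open>Zero sets and cut-off functions\<close>

text \<open>Near such a point some partial derivative of \<open>f\<close> is nonzero. By the inverse
  function theorem \<open>f\<close> can then serve as a coordinate, so the zero set is locally
  contained in the image of a piece of a hyperplane under a differentiable map, which is a null
  set.\<close>

lemma negligible_zero_set_nonzero_derivative:
  fixes f :: "'a::euclidean_space \<Rightarrow> real"
  assumes "open S"
    and deriv: "\<And>x. x \<in> S \<Longrightarrow> (f has_derivative (\<lambda>h. w x \<bullet> h)) (at x)"
    and cont: "continuous_on S w"
  shows "negligible {x \<in> S. f x = 0 \<and> w x \<noteq> 0}" (is "negligible ?Z")
proof (rule locally_negligible_alt[THEN iffD2], rule ballI)
  fix x0 assume x0: "x0 \<in> ?Z"
  then obtain b where b: "b \<in> Basis" "w x0 \<bullet> b \<noteq> 0"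
    using euclidean_all_zero_iff by blast
  \<comment> \<open>\<open>T\<close> replaces the \<open>b\<close>-coordinate by the value of \<open>f\<close>, so it straightens the zero set of \<open>f\<close>.\<close>
  define T where "T x = x + (f x - x \<bullet> b) *\<^sub>R b" for x
  define T' where "T' x = id_blinfun + (blinfun_scaleR_left b o\<^sub>L blinfun_inner_right (w x - b))" for x
  have T': "blinfun_apply (T' x) h = h + (w x \<bullet> h - h \<bullet> b) *\<^sub>R b" for x h
    by (simp add: T'_def plus_blinfun.rep_eq inner_diff_left inner_diff_right inner_commute)
  \<comment> \<open>\<open>R\<close> solves \<open>k = T' x0 h\<close> for \<open>h\<close>. Pairing
    with \<open>b\<close> gives \<open>k \<bullet> b = w x0 \<bullet> h\<close>; pairing with
    \<open>w x0\<close> then determines the missing multiple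
    \<open>h \<bullet> b - w x0 \<bullet> h\<close> of \<open>b\<close> after division by
    \<open>w x0 \<bullet> b\<close>.\<close>
  define R where "R = id_blinfun +
    (blinfun_scaleR_left b o\<^sub>L blinfun_inner_right ((1 / (w x0 \<bullet> b)) *\<^sub>R (b - w x0)))"
  have inv: "R o\<^sub>L T' x0 = id_blinfun"
  proof (rule blinfun_eqI)
    fix h
    have "blinfun_apply R k = k + ((k \<bullet> b - w x0 \<bullet> k) / (w x0 \<bullet> b)) *\<^sub>R b" for k
      by (simp add: R_def plus_blinfun.rep_eq inner_diff_left inner_diff_right inner_commute)
    moreover have "blinfun_apply (T' x0) h \<bullet> b = w x0 \<bullet> h"
      using b by (simp add: T' inner_add_left)
    moreover have "w x0 \<bullet> h - w x0 \<bullet> blinfun_apply (T' x0) h = (h \<bullet> b - w x0 \<bullet> h) * (w x0 \<bullet> b)"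
      by (simp add: T' inner_add_right left_diff_distrib)
    ultimately have "blinfun_apply R (blinfun_apply (T' x0) h)
        = blinfun_apply (T' x0) h + (h \<bullet> b - w x0 \<bullet> h) *\<^sub>R b"
      using b by simp
    then show "blinfun_apply (R o\<^sub>L T' x0) h = blinfun_apply id_blinfun h"
      by (simp add: T' flip: scaleR_left_distrib)
  qed
  have deriv_T: "(T has_derivative blinfun_apply (T' x)) (at x)" if "x \<in> S" for x
    unfolding T_def T'
    by (intro has_derivative_add has_derivative_ident has_derivative_scaleR_left
        has_derivative_diff deriv[OF that] has_derivative_inner_left)
  have cont_T': "continuous_on S T'"
    unfolding T'
    by (rule continuous_on_blinfun_componentwise) (unfold T', intro continuous_intros cont)
  have "x0 \<in> S" using x0 by simp
  obtain U V g g' where UV: "open U" "x0 \<in> U" "homeomorphism U V T g"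
      and g': "\<And>y. y \<in> V \<Longrightarrow> (g has_derivative g' y) (at y)"
    by (rule inverse_function_theorem[OF \<open>open S\<close> deriv_T cont_T' \<open>x0 \<in> S\<close> inv]) (simp, rule that)
  have "negligible (g ` (V \<inter> {y. b \<bullet> y = 0}))"
  proof (rule negligible_differentiable_image_negligible)
    show "negligible (V \<inter> {y. b \<bullet> y = 0})"
      using b by (intro negligible_subset[OF negligible_hyperplane[of b 0]]) auto
    show "g differentiable_on V \<inter> {y. b \<bullet> y = 0}"
      unfolding differentiable_on_def differentiable_def
      using g' has_derivative_at_withinI by blast
  qed simp
  moreover have "?Z \<inter> U \<subseteq> g ` (V \<inter> {y. b \<bullet> y = 0})"
  proof
    fix x assume x: "x \<in> ?Z \<inter> U"
    then have "T x \<in> V" "g (T x) = x"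
      using UV(3) by (auto simp: homeomorphism_def)
    moreover have "b \<bullet> T x = 0"
      using x b by (simp add: T_def inner_add_right inner_diff_right inner_commute)
    ultimately show "x \<in> g ` (V \<inter> {y. b \<bullet> y = 0})"
      by (intro image_eqI[of x g "T x"]) simp_all
  qed
  ultimately have "negligible (?Z \<inter> U)"
    by (rule negligible_subset)
  moreover have "openin (top_of_set ?Z) (?Z \<inter> U)"
    using UV by (intro openin_open_Int)
  ultimately show "\<exists>W. openin (top_of_set ?Z) W \<and> x0 \<in> W \<and> negligible W"
    using x0 UV(2) by (intro exI[of _ "?Z \<inter> U"]) simp
qed

lemma has_real_derivative_max_0_squared:
  "((\<lambda>s::real. (max 0 s)\<^sup>2) has_real_derivative 2 * max 0 s) (at s)"
proof -
  consider "s < 0" | "s > 0" | "s = 0" by linarith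
  then show ?thesis
  proof cases
    case 1
    then have "((\<lambda>s. 0) has_real_derivative 2 * max 0 s) (at s)" by simp
    then show ?thesis
      by (rule has_field_derivative_transform_within_open[of _ _ _ "{..<0}"]) (use 1 in auto)
  next
    case 2
    then have "((\<lambda>s. s\<^sup>2) has_real_derivative 2 * max 0 s) (at s)"
      by (auto intro!: derivative_eq_intros)
    then show ?thesis
      by (rule has_field_derivative_transform_within_open[of _ _ _ "{0<..}"]) (use 2 in auto)
  next
    case 3
    have "(\<lambda>h::real. (max 0 h)\<^sup>2 / h) \<midarrow>0\<rightarrow> 0"
    proof (rule Lim_null_comparison)
      show "\<forall>\<^sub>F h in at 0. norm ((max 0 h)\<^sup>2 / h) \<le> \<bar>h\<bar>"
        by (rule always_eventually) (auto simp: max_def power2_eq_square)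
      show "(\<lambda>h::real. \<bar>h\<bar>) \<midarrow>0\<rightarrow> 0"
        using tendsto_rabs_zero[OF tendsto_ident_at] by simp
    qed
    then show ?thesis
      using 3 by (simp add: DERIV_def)
  qed
qed

text \<open>On the unit interval the witness is \<open>1 - (1 - s\<^sup>2)\<^sup>2\<close>; squares
  of positive parts join it to the constants 0 and 1 with continuous derivative. For
  \<open>s \<le> 1\<close> the derivative is a product of two factors of size at most 2, hence the
  bound 4.\<close>

lemma C1_step_function:
  obtains \<psi> \<psi>' :: "real \<Rightarrow> real" where
    "\<And>s. (\<psi> has_real_derivative \<psi>' s) (at s)" "continuous_on UNIV \<psi>'"
    "\<And>s. s \<le> 0 \<Longrightarrow> \<psi> s = 0" "\<And>s. 1 \<le> s \<Longrightarrow> \<psi> s = 1"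
    "\<And>s. s \<le> 0 \<or> 1 \<le> s \<Longrightarrow> \<psi>' s = 0"
    "\<And>s. \<bar>\<psi> s\<bar> \<le> 1" "\<And>s. \<bar>\<psi>' s\<bar> \<le> 4"
proof
  let ?r = "\<lambda>s::real. (max 0 s)\<^sup>2"
  have r1: "1 \<le> ?r s" if "1 \<le> s" for s
    using that by simp
  show "((\<lambda>s. 1 - ?r (1 - ?r s)) has_real_derivative
      (2 * max 0 (1 - ?r s)) * (2 * max 0 s)) (at s)" for s
    by (rule derivative_eq_intros DERIV_chain'[OF _ has_real_derivative_max_0_squared]
        has_real_derivative_max_0_squared refl)+ simp
  show "continuous_on UNIV (\<lambda>s. (2 * max 0 (1 - ?r s)) * (2 * max 0 s))"
    by (intro continuous_intros)
  show "1 - ?r (1 - ?r s) = 0" if "s \<le> 0" for s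
    using that by simp
  show "1 - ?r (1 - ?r s) = 1" if "1 \<le> s" for s
    using r1[OF that] by (simp add: max_absorb1)
  show "(2 * max 0 (1 - ?r s)) * (2 * max 0 s) = 0" if "s \<le> 0 \<or> 1 \<le> s" for s
    using that
  proof
    assume "1 \<le> s"
    then have "max 0 (1 - ?r s) = 0" using r1 by (simp add: max_absorb1)
    then show ?thesis by simp
  qed simp
  have *: "0 \<le> max 0 (1 - ?r s)" "max 0 (1 - ?r s) \<le> 1" for s
    by auto
  show "\<bar>1 - ?r (1 - ?r s)\<bar> \<le> 1" for s
    using power_le_one[OF *, of s 2] zero_le_power2[of "max 0 (1 - ?r s)"] by simp
  show "\<bar>(2 * max 0 (1 - ?r s)) * (2 * max 0 s)\<bar> \<le> 4" for s
  proof (cases "s \<le> 1")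
    case True
    have "\<bar>(2 * max 0 (1 - ?r s)) * (2 * max 0 s)\<bar> = 4 * (max 0 (1 - ?r s) * max 0 s)"
      by (simp add: abs_mult)
    also have "max 0 (1 - ?r s) * max 0 s \<le> 1 * 1"
      using True * by (intro mult_mono) auto
    finally show ?thesis by simp
  next
    case False
    then have "max 0 (1 - ?r s) = 0" using r1[of s] by (simp add: max_absorb1)
    then show ?thesis by simp
  qed
qed

section \<open>Perturbations vanishing on the boundary\<close>

text \<open>Turns entrywise bounds into a constant that dominates the determinants, for
  integrability and for dominated convergence.\<close>

lemma abs_det_bounded:
  "\<exists>D. \<forall>A :: real^'n^'n. (\<forall>i j. \<bar>A $ i $ j\<bar> \<le> C) \<longrightarrow> \<bar>det A\<bar> \<le> D"
proof (intro exI allI impI)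
  fix A :: "real^'n^'n" assume A: "\<forall>i j. \<bar>A $ i $ j\<bar> \<le> C"
  have "\<bar>det A\<bar> \<le> (\<Sum>p | p permutes (UNIV :: 'n set). \<bar>of_int (sign p) * (\<Prod>i\<in>UNIV. A $ i $ p i)\<bar>)"
    unfolding det_def by (rule sum_abs)
  also have "\<dots> \<le> (\<Sum>p | p permutes (UNIV :: 'n set). \<Prod>i\<in>(UNIV :: 'n set). C)"
    by (intro sum_mono)
      (simp only: abs_mult abs_prod of_int_abs[symmetric] abs_sign of_int_1 mult_1,
        intro prod_mono, simp add: A)
  finally show "\<bar>det A\<bar> \<le> (\<Sum>p | p permutes (UNIV :: 'n set). \<Prod>i\<in>(UNIV :: 'n set). C)" .
qed

text \<open>This rank-one matrix is the term of the product rule in which the scalar factor, with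
  gradient \<open>w\<close>, is differentiated and the vector factor \<open>v\<close> is
  kept.\<close>

definition outer_product :: "real^'m \<Rightarrow> real^'n \<Rightarrow> real^'n^'m" where
  "outer_product v w = (\<chi> i j. v $ i * w $ j)"

lemma outer_product_mult: "outer_product v w *v h = (w \<bullet> h) *\<^sub>R v"
  by (simp add: outer_product_def matrix_vector_mult_def vec_eq_iff inner_vec_def sum_distrib_left
      sum_distrib_right mult_ac)

lemma outer_product_0_right [simp]: "outer_product v 0 = 0"
  by (simp add: outer_product_def vec_eq_iff)

lemma continuous_on_outer_product [continuous_intros]:
  assumes "continuous_on S f" "continuous_on S g"
  shows "continuous_on S (\<lambda>x. outer_product (f x) (g x))"
  unfolding outer_product_def by (intro continuous_intros assms)

lemma continuous_on_vector_matrix_mult [continuous_intros]: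
  fixes A :: "'a::topological_space \<Rightarrow> real^'n^'m"
  assumes "continuous_on S v" "continuous_on S A"
  shows "continuous_on S (\<lambda>x. v x v* A x)"
  unfolding vector_matrix_mult_def by (intro continuous_intros assms)

lemma has_derivative_scaleR_matrix:
  fixes G :: "real^'n \<Rightarrow> real^'m"
  assumes "(f has_derivative (\<lambda>h. w \<bullet> h)) (at x)" "(G has_derivative (\<lambda>h. B *v h)) (at x)"
  shows "((\<lambda>x. f x *\<^sub>R G x) has_derivative (\<lambda>h. (f x *\<^sub>R B + outer_product (G x) w) *v h)) (at x)"
  using has_derivative_scaleR[OF assms]
  by (simp add: matrix_vector_mult_add_rdistrib outer_product_mult scaleR_matrix_vector_assoc)

text \<open>The vector \<open>u x v* U\<close> is half the gradient of
  \<open>u x \<bullet> u x\<close>, whence the factor 2.\<close>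

lemma has_derivative_compose_norm_squared:
  fixes u :: "real^'n \<Rightarrow> real^'m"
  assumes \<psi>: "\<And>s. (\<psi> has_real_derivative \<psi>' s) (at s)"
    and u: "(u has_derivative (\<lambda>h. U *v h)) (at x)"
  shows "((\<lambda>x. \<psi> (c * (u x \<bullet> u x) - 1)) has_derivative
    (\<lambda>h. ((2 * c * \<psi>' (c * (u x \<bullet> u x) - 1)) *\<^sub>R (u x v* U)) \<bullet> h)) (at x)"
proof -
  have "((\<lambda>x. c * (u x \<bullet> u x) - 1) has_derivative
      (\<lambda>h. c * (u x \<bullet> (U *v h) + (U *v h) \<bullet> u x) - 0)) (at x)"
    by (intro has_derivative_diff has_derivative_const has_derivative_mult_right has_derivative_inner u)
  from has_derivative_compose[OF this \<psi>[THEN has_field_derivative_imp_has_derivative]]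
  show ?thesis
    by (rule has_derivative_eq_rhs)
      (simp add: fun_eq_iff dot_lmul_matrix inner_commute[of "U *v _"] algebra_simps)
qed

text \<open>Since \<open>G\<close> need not vanish on the boundary, it is cut off as well, at half
  the level used for \<open>u\<close>. The matrices \<open>N\<close> and \<open>N + M\<close> are
  then Jacobians of maps supported in a compact subset of \<open>S\<close>, so both determinants
  integrate to 0, and \<open>N\<close> may be replaced by \<open>B\<close> in their difference
  because \<open>M\<close> vanishes wherever \<open>N\<close> and \<open>B\<close> differ.\<close>

lemma has_integral_det_truncated_perturbation:
  fixes u G :: "real^'n \<Rightarrow> real^'n" and U B :: "real^'n \<Rightarrow> real^'n^'n"
  assumes \<psi>: "\<And>s. (\<psi> has_real_derivative \<psi>' s) (at s)" "continuous_on UNIV \<psi>'"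
    "\<And>s. s \<le> 0 \<Longrightarrow> \<psi> s = 0" "\<And>s. 1 \<le> s \<Longrightarrow> \<psi> s = 1"
    "\<And>s. s \<le> 0 \<or> 1 \<le> s \<Longrightarrow> \<psi>' s = 0"
    and S: "open S" "bounded S" and "c > 0"
    and u: "continuous_on (closure S) u" "\<And>x. x \<in> frontier S \<Longrightarrow> u x = 0"
    and du: "\<And>x. x \<in> S \<Longrightarrow> (u has_derivative (\<lambda>h. U x *v h)) (at x)" and U: "continuous_on S U"
    and dG: "\<And>x. x \<in> S \<Longrightarrow> (G has_derivative (\<lambda>h. B x *v h)) (at x)" and B: "continuous_on S B"
  defines "M \<equiv> \<lambda>x. \<psi> (c * (u x \<bullet> u x) - 1) *\<^sub>R U x +
      outer_product (u x) ((2 * c * \<psi>' (c * (u x \<bullet> u x) - 1)) *\<^sub>R (u x v* U x))"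
  shows "((\<lambda>x. det (B x + M x) - det (B x)) has_integral 0) S"
proof -
  define N where "N x = \<psi> ((2 * c) * (u x \<bullet> u x) - 1) *\<^sub>R B x +
      outer_product (G x) ((2 * (2 * c) * \<psi>' ((2 * c) * (u x \<bullet> u x) - 1)) *\<^sub>R (u x v* U x))" for x
  \<comment> \<open>Below the level \<open>1 / (2 * c)\<close> both cut-offs are 0. The level is
    positive, so \<open>K\<close> misses the frontier, where \<open>u\<close> vanishes.\<close>
  define K where "K = closure S \<inter> (\<lambda>x. u x \<bullet> u x) -` {1 / (2 * c)..}"
  have "closed K"
    unfolding K_def by (intro continuous_closed_preimage continuous_intros u) auto
  moreover have "bounded K"
    using bounded_closure[OF \<open>bounded S\<close>] by (rule bounded_subset) (simp add: K_def)
  ultimately have "compact K"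
    by (simp add: compact_eq_bounded_closed)
  have "K \<subseteq> S"
  proof
    fix x assume x: "x \<in> K"
    then have "x \<in> closure S" and "u x \<noteq> 0"
      using \<open>c > 0\<close> by (auto simp: K_def)
    then show "x \<in> S"
      using u(2) \<open>open S\<close> by (auto simp: frontier_def interior_open)
  qed
  have outside: "\<psi> (c * (u x \<bullet> u x) - 1) = 0" "\<psi> ((2 * c) * (u x \<bullet> u x) - 1) = 0"
    if "x \<in> S" "x \<notin> K" for x
  proof -
    have "u x \<bullet> u x < 1 / (2 * c)"
      using that closure_subset by (auto simp: K_def)
    then have "(2 * c) * (u x \<bullet> u x) \<le> 1"
      using \<open>c > 0\<close> by (simp add: field_simps)
    moreover have "0 \<le> c * (u x \<bullet> u x)"
      using \<open>c > 0\<close> by simp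
    ultimately show "\<psi> (c * (u x \<bullet> u x) - 1) = 0" "\<psi> ((2 * c) * (u x \<bullet> u x) - 1) = 0"
      by (auto intro!: \<psi>(3))
  qed
  have "continuous_on UNIV \<psi>"
    using \<psi>(1) by (meson DERIV_isCont continuous_at_imp_continuous_on)
  note \<psi>_cont = continuous_on_compose2[OF this] continuous_on_compose2[OF \<psi>(2)]
  have contS: "continuous_on S u" "continuous_on S G"
    using du dG by (meson continuous_at_imp_continuous_on has_derivative_continuous)+
  have M_cont: "continuous_on S M" and N_cont: "continuous_on S N"
    unfolding M_def N_def by (intro continuous_intros \<psi>_cont contS U B subset_UNIV)+
  have N_deriv: "((\<lambda>x. \<psi> ((2 * c) * (u x \<bullet> u x) - 1) *\<^sub>R G x) has_derivative (\<lambda>h. N x *v h)) (at x)"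
    and M_deriv: "((\<lambda>x. \<psi> (c * (u x \<bullet> u x) - 1) *\<^sub>R u x) has_derivative (\<lambda>h. M x *v h)) (at x)"
    if "x \<in> S" for x
    unfolding N_def M_def
    by (intro has_derivative_scaleR_matrix has_derivative_compose_norm_squared \<psi> du dG that)+
  have int_N: "((\<lambda>x. det (N x)) has_integral 0) S"
    by (rule has_integral_det_compact_support[OF \<open>open S\<close> \<open>compact K\<close> \<open>K \<subseteq> S\<close> N_deriv N_cont])
      (simp_all add: outside)
  have int_NM: "((\<lambda>x. det (N x + M x)) has_integral 0) S"
  proof (rule has_integral_det_compact_support[OF \<open>open S\<close> \<open>compact K\<close> \<open>K \<subseteq> S\<close>])
    show "((\<lambda>x. \<psi> ((2 * c) * (u x \<bullet> u x) - 1) *\<^sub>R G x + \<psi> (c * (u x \<bullet> u x) - 1) *\<^sub>R u x)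
        has_derivative (\<lambda>h. (N x + M x) *v h)) (at x)" if "x \<in> S" for x
      using has_derivative_add[OF N_deriv M_deriv, OF that that]
      by (simp add: matrix_vector_mult_add_rdistrib)
  qed (intro continuous_intros M_cont N_cont, simp_all add: outside)
  have "((\<lambda>x. det (N x + M x) - det (N x)) has_integral 0) S"
    using has_integral_diff[OF int_NM int_N] by simp
  moreover have "det (N x + M x) - det (N x) = det (B x + M x) - det (B x)" for x
  \<comment> \<open>In the first case the inner cut-off and its derivative vanish. In the second,
    \<open>(2 * c) * (u x \<bullet> u x) - 1\<close> exceeds 1, so the outer cut-off is 1 with
    derivative 0.\<close>
  proof (cases "c * (u x \<bullet> u x) \<le> 1")
    case True
    then have "M x = 0"
      by (simp add: M_def \<psi>)
    then show ?thesis by simp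
  next
    case False
    then have "N x = B x"
      by (simp add: N_def \<psi>)
    then show ?thesis by simp
  qed
  ultimately show ?thesis by simp
qed

text \<open>Dominated convergence in the truncated identity as the cut-off level tends to 0: the
  truncated Jacobians are bounded uniformly in the level, and at each point outside the null set
  \<open>Z\<close> they eventually equal \<open>U x\<close>.\<close>

lemma has_integral_det_perturbation:
  fixes u G :: "real^'n \<Rightarrow> real^'n" and U B :: "real^'n \<Rightarrow> real^'n^'n"
  assumes S: "open S" "bounded S"
    and u: "continuous_on (closure S) u" "\<And>x. x \<in> frontier S \<Longrightarrow> u x = 0"
    and du: "\<And>x. x \<in> S \<Longrightarrow> (u has_derivative (\<lambda>h. U x *v h)) (at x)" and U: "continuous_on S U"
    and dG: "\<And>x. x \<in> S \<Longrightarrow> (G has_derivative (\<lambda>h. B x *v h)) (at x)" and B: "continuous_on S B"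
    and C: "\<And>x i j. x \<in> S \<Longrightarrow> \<bar>U x $ i $ j\<bar> \<le> C" "\<And>x i j. x \<in> S \<Longrightarrow> \<bar>B x $ i $ j\<bar> \<le> C"
  shows "((\<lambda>x. det (B x + U x) - det (B x)) has_integral 0) S"
proof -
  obtain \<psi> \<psi>' :: "real \<Rightarrow> real" where
    \<psi>: "\<And>s. (\<psi> has_real_derivative \<psi>' s) (at s)" "continuous_on UNIV \<psi>'"
    "\<And>s. s \<le> 0 \<Longrightarrow> \<psi> s = 0" "\<And>s. 1 \<le> s \<Longrightarrow> \<psi> s = 1"
    "\<And>s. s \<le> 0 \<or> 1 \<le> s \<Longrightarrow> \<psi>' s = 0"
    and \<psi>_bound: "\<And>s. \<bar>\<psi> s\<bar> \<le> 1" "\<And>s. \<bar>\<psi>' s\<bar> \<le> 4"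
    by (rule C1_step_function) (rule that)
  \<comment> \<open>The derivative of \<open>\<psi> (c \<bar>u\<bar>\<^sup>2 - 1) u\<close>; it is bounded uniformly in \<open>c\<close>, as \<open>\<psi>'\<close> is nonzero only
    where \<open>c \<bar>u\<bar>\<^sup>2 \<le> 2\<close>.\<close>
  define M where "M c x = \<psi> (c * (u x \<bullet> u x) - 1) *\<^sub>R U x +
      outer_product (u x) ((2 * c * \<psi>' (c * (u x \<bullet> u x) - 1)) *\<^sub>R (u x v* U x))" for c x
  define Z where "Z = {x \<in> S. u x = 0 \<and> U x \<noteq> 0}"
  have "negligible Z"
  proof -
    \<comment> \<open>If \<open>U x \<noteq> 0\<close>, some row of it is nonzero, and that row is
      the gradient of a component of \<open>u\<close> vanishing at \<open>x\<close>. So these sets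
      cover \<open>Z\<close>.\<close>
    have "negligible {x \<in> S. u x $ i = 0 \<and> U x $ i \<noteq> 0}" for i
    proof (rule negligible_zero_set_nonzero_derivative[OF \<open>open S\<close>])
      show "((\<lambda>x. u x $ i) has_derivative (\<lambda>h. U x $ i \<bullet> h)) (at x)" if "x \<in> S" for x
        using bounded_linear.has_derivative[OF bounded_linear_vec_nth du[OF that], of i]
        by (simp add: matrix_vector_mul_component)
      show "continuous_on S (\<lambda>x. U x $ i)"
        by (intro continuous_intros U)
    qed
    then have "negligible (\<Union>i. {x \<in> S. u x $ i = 0 \<and> U x $ i \<noteq> 0})"
      by (intro negligible_Union) auto
    then show ?thesis
      by (rule negligible_subset) (auto simp: Z_def vec_eq_iff)
  qed
  \<comment> \<open>The 1 comes from \<open>\<bar>\<psi>\<bar> \<le> 1\<close>. The 16 is 2 * 4 * 2: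
    the factor 2 of the gradient, the bound on \<open>\<psi>'\<close>, and
    \<open>c * (u x \<bullet> u x) \<le> 2\<close> wherever \<open>\<psi>'\<close> is nonzero. The
    dimension counts the summands of an entry of \<open>u x v* U x\<close>.\<close>
  define C' where "C' = C * (1 + 16 * real CARD('n))"
  have M_bound: "\<bar>M c x $ i $ j\<bar> \<le> C'" if x: "x \<in> S" and "c > 0" for c x i j
  proof -
    let ?w = "u x \<bullet> u x"
    have "0 \<le> C" using C(1)[OF x, of i j] by linarith
    have "\<bar>u x $ i * (u x v* U x) $ j\<bar> \<le> ?w * (real CARD('n) * C)"
    proof -
      have "\<bar>u x $ i * (u x v* U x) $ j\<bar> \<le> (\<Sum>k\<in>UNIV. \<bar>u x $ i * (u x $ k * U x $ k $ j)\<bar>)"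
        unfolding vector_matrix_mult_def by (simp add: sum_distrib_left mult.commute)
      also have "\<dots> \<le> (\<Sum>k\<in>(UNIV :: 'n set). ?w * C)"
      proof (rule sum_mono)
        fix k
        have "\<bar>u x $ i\<bar> * \<bar>u x $ k\<bar> \<le> norm (u x) * norm (u x)"
          by (intro mult_mono component_le_norm_cart) auto
        also have "\<dots> = ?w"
          by (simp add: power2_norm_eq_inner flip: power2_eq_square)
        finally have "(\<bar>u x $ i\<bar> * \<bar>u x $ k\<bar>) * \<bar>U x $ k $ j\<bar> \<le> ?w * C"
          using C(1)[OF x] by (intro mult_mono) auto
        then show "\<bar>u x $ i * (u x $ k * U x $ k $ j)\<bar> \<le> ?w * C"
          by (simp add: abs_mult mult.assoc)
      qed
      finally show ?thesis by (simp add: mult_ac)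
    qed
    then have "\<bar>2 * c * \<psi>' (c * ?w - 1)\<bar> * \<bar>u x $ i * (u x v* U x) $ j\<bar>
        \<le> \<bar>2 * c * \<psi>' (c * ?w - 1)\<bar> * (?w * (real CARD('n) * C))"
      by (intro mult_left_mono) auto
    also have "\<dots> = 2 * \<bar>\<psi>' (c * ?w - 1)\<bar> * (c * ?w) * (real CARD('n) * C)"
      using \<open>c > 0\<close> by (simp add: abs_mult)
    also have "\<dots> \<le> 16 * (real CARD('n) * C)"
    proof (cases "c * ?w \<le> 2")
      case True
      have "2 * \<bar>\<psi>' (c * ?w - 1)\<bar> * (c * ?w) \<le> 2 * 4 * 2"
        using True \<psi>_bound \<open>c > 0\<close> by (intro mult_mono) auto
      then show ?thesis
        using \<open>0 \<le> C\<close> by (intro mult_right_mono) auto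
    next
      case False
      then have "\<psi>' (c * ?w - 1) = 0" by (intro \<psi>) auto
      then show ?thesis using \<open>0 \<le> C\<close> by simp
    qed
    finally have 1: "\<bar>2 * c * \<psi>' (c * ?w - 1)\<bar> * \<bar>u x $ i * (u x v* U x) $ j\<bar> \<le> 16 * (real CARD('n) * C)" .
    have 2: "\<bar>\<psi> (c * ?w - 1)\<bar> * \<bar>U x $ i $ j\<bar> \<le> 1 * C"
      using \<psi>_bound C(1)[OF x] by (intro mult_mono) auto
    have "M c x $ i $ j = \<psi> (c * ?w - 1) * U x $ i $ j
        + (2 * c * \<psi>' (c * ?w - 1)) * (u x $ i * (u x v* U x) $ j)"
      by (simp add: M_def outer_product_def)
    then have "\<bar>M c x $ i $ j\<bar> \<le> \<bar>\<psi> (c * ?w - 1)\<bar> * \<bar>U x $ i $ j\<bar>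
        + \<bar>2 * c * \<psi>' (c * ?w - 1)\<bar> * \<bar>u x $ i * (u x v* U x) $ j\<bar>"
      by (simp only: abs_mult[symmetric] abs_triangle_ineq)
    also have "\<dots> \<le> C'"
      using 1 2 by (simp add: C'_def algebra_simps)
    finally show ?thesis .
  qed
  obtain D1 where D1: "\<forall>A :: real^'n^'n. (\<forall>i j. \<bar>A $ i $ j\<bar> \<le> C + C') \<longrightarrow> \<bar>det A\<bar> \<le> D1"
    using abs_det_bounded ..
  obtain D2 where D2: "\<forall>A :: real^'n^'n. (\<forall>i j. \<bar>A $ i $ j\<bar> \<le> C) \<longrightarrow> \<bar>det A\<bar> \<le> D2"
    using abs_det_bounded ..
  have spike: "(f has_integral y) (S - Z) \<longleftrightarrow> (f has_integral y) S" for f :: "real^'n \<Rightarrow> real" and y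
    by (rule has_integral_spike_set_eq; rule negligible_subset[OF \<open>negligible Z\<close>]; auto)
  have "((\<lambda>x. det (B x + U x) - det (B x)) has_integral 0) (S - Z)"
  proof (rule has_integral_dominated_convergence)
    \<comment> \<open>The successor keeps the cut-off parameter positive also for
      \<open>n = 0\<close>.\<close>
    show "((\<lambda>x. det (B x + M (real (Suc n)) x) - det (B x)) has_integral 0) (S - Z)" for n
      unfolding spike M_def
      by (rule has_integral_det_truncated_perturbation[OF \<psi> S _ u du U dG B]) simp_all
    have "S \<in> lmeasurable"
      using S by (simp add: lmeasurable_open)
    then have "S - Z \<in> lmeasurable"
      using \<open>negligible Z\<close> by (simp add: fmeasurable_Diff negligible_imp_sets)
    then show "(\<lambda>x. D1 + D2) integrable_on (S - Z)"
      by (rule integrable_on_const)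
    show "\<forall>x\<in>S - Z. norm (det (B x + M (real (Suc n)) x) - det (B x)) \<le> D1 + D2" for n
    proof
      fix x assume "x \<in> S - Z"
      then have x: "x \<in> S" by simp
      have "\<bar>det (B x + M (real (Suc n)) x)\<bar> \<le> D1"
      proof (rule D1[rule_format])
        fix i j
        show "\<bar>(B x + M (real (Suc n)) x) $ i $ j\<bar> \<le> C + C'"
          using abs_triangle_ineq[of "B x $ i $ j" "M (real (Suc n)) x $ i $ j"] C(2)[OF x, of i j]
            M_bound[OF x, of "real (Suc n)" i j] by simp
      qed
      moreover have "\<bar>det (B x)\<bar> \<le> D2"
        using C(2)[OF x] D2 by simp
      ultimately show "norm (det (B x + M (real (Suc n)) x) - det (B x)) \<le> D1 + D2"
        by (simp add: abs_le_iff)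
    qed
    show "\<forall>x\<in>S - Z. (\<lambda>n. det (B x + M (real (Suc n)) x) - det (B x)) \<longlonglongrightarrow> det (B x + U x) - det (B x)"
    proof
      fix x assume x: "x \<in> S - Z"
      \<comment> \<open>If \<open>u x = 0\<close>, both sides are 0, since \<open>x\<close> is
        outside \<open>Z\<close>. Otherwise the argument of \<open>\<psi>\<close> eventually exceeds
        1, where \<open>\<psi>\<close> is 1 and \<open>\<psi>'\<close> is 0.\<close>
      have "\<forall>\<^sub>F n in sequentially. M (real (Suc n)) x = U x"
      proof (cases "u x = 0")
        case True
        then have "U x = 0" using x by (auto simp: Z_def)
        then show ?thesis using True by (simp add: M_def)
      next
        case False
        then have "0 < u x \<bullet> u x" by simp
        then obtain n0 where n0: "2 < real n0 * (u x \<bullet> u x)"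
          using reals_Archimedean3 by blast
        have "M (real (Suc n)) x = U x" if "n0 \<le> n" for n
        proof -
          have "real n0 * (u x \<bullet> u x) \<le> real (Suc n) * (u x \<bullet> u x)"
            using that by (intro mult_right_mono) auto
          then have "1 \<le> real (Suc n) * (u x \<bullet> u x) - 1" using n0 by linarith
          then have "\<psi> (real (Suc n) * (u x \<bullet> u x) - 1) = 1" "\<psi>' (real (Suc n) * (u x \<bullet> u x) - 1) = 0"
            using \<psi> by blast+
          then show ?thesis by (simp only: M_def) simp
        qed
        then show ?thesis
          using eventually_sequentially by blast
      qed
      then show "(\<lambda>n. det (B x + M (real (Suc n)) x) - det (B x)) \<longlonglongrightarrow> det (B x + U x) - det (B x)"
        by (intro tendsto_eventually) (auto elim: eventually_mono)
    qed
  qed simp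
  then show ?thesis
    unfolding spike .
qed

section \<open>Jacobians of maps of class C1 up to the boundary\<close>

lemma C1_closure_has_derivative:
  assumes "C1_closure S F" "x \<in> S"
  shows "(F has_derivative (\<lambda>h. jacobian F (at x) *v h)) (at x)"
  using assms unfolding C1_closure_def C1_on_def
  by (metis differentiableI jacobian_works)

lemma C1_closure_continuous_on_jacobian:
  assumes "C1_closure S F"
  shows "continuous_on S (\<lambda>x. jacobian F (at x))"
proof -
  have "continuous_on S (\<lambda>x. jacobian F (at x) $ i $ j)" for i j
  proof -
    obtain g where g: "continuous_on (closure S) g" "\<forall>x\<in>S. g x = jacobian F (at x) $ i $ j"
      using assms unfolding C1_closure_def by blast
    have "continuous_on S g"
      using g(1) closure_subset by (rule continuous_on_subset)
    then show ?thesis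
      by (rule continuous_on_eq) (simp add: g)
  qed
  then have "continuous_on S (\<lambda>x. \<chi> i j. jacobian F (at x) $ i $ j)"
    by (intro continuous_on_vec_lambda)
  then show ?thesis by simp
qed

text \<open>Each entry extends continuously to the closure, which is compact because
  \<open>S\<close> is bounded.\<close>

lemma C1_closure_bounded_jacobian:
  fixes F :: "real^'n \<Rightarrow> real^'m"
  assumes "C1_closure S F" "bounded S"
  obtains C where "\<And>x i j. x \<in> S \<Longrightarrow> \<bar>jacobian F (at x) $ i $ j\<bar> \<le> C"
proof -
  have "\<exists>c. \<forall>x\<in>S. \<bar>jacobian F (at x) $ i $ j\<bar> \<le> c" for i j
  proof -
    obtain g where g: "continuous_on (closure S) g" "\<forall>x\<in>S. g x = jacobian F (at x) $ i $ j"
      using assms unfolding C1_closure_def by blast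
    have "bounded (g ` closure S)"
      using assms(2) g(1) by (intro compact_imp_bounded compact_continuous_image) auto
    then obtain c where "\<forall>x\<in>closure S. \<bar>g x\<bar> \<le> c"
      by (auto simp: bounded_iff)
    then show ?thesis
      using g(2) closure_subset by (metis subsetD)
  qed
  then obtain c where c: "\<And>i j x. x \<in> S \<Longrightarrow> \<bar>jacobian F (at x) $ i $ j\<bar> \<le> c i j"
    by metis
  \<comment> \<open>The sum of absolute values is one constant above all the entrywise
    bounds.\<close>
  have "c i j \<le> (\<Sum>i\<in>UNIV. \<Sum>j\<in>UNIV. \<bar>c i j\<bar>)" for i j
  proof -
    have "c i j \<le> \<bar>c i j\<bar>" by simp
    also have "\<dots> \<le> (\<Sum>j\<in>UNIV. \<bar>c i j\<bar>)"
      by (rule member_le_sum) auto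
    also have "\<dots> \<le> (\<Sum>i\<in>UNIV. \<Sum>j\<in>UNIV. \<bar>c i j\<bar>)"
      by (rule member_le_sum[where f = "\<lambda>i. \<Sum>j\<in>UNIV. \<bar>c i j\<bar>"]) (auto intro: sum_nonneg)
    finally show ?thesis .
  qed
  then have "\<bar>jacobian F (at x) $ i $ j\<bar> \<le> (\<Sum>i\<in>UNIV. \<Sum>j\<in>UNIV. \<bar>c i j\<bar>)" if "x \<in> S" for x i j
    using c[OF that] by (rule order_trans[rotated])
  then show ?thesis by (rule that)
qed

lemma set_integrable_det_jacobian:
  fixes F :: "real^'n \<Rightarrow> real^'n"
  assumes "C1_closure S F" "open S" "bounded S"
  shows "set_integrable lebesgue S (\<lambda>x. det (jacobian F (at x)))"
proof -
  obtain C where C: "\<And>x i j. x \<in> S \<Longrightarrow> \<bar>jacobian F (at x) $ i $ j\<bar> \<le> C"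
    using C1_closure_bounded_jacobian assms by metis
  obtain D where D: "\<forall>A :: real^'n^'n. (\<forall>i j. \<bar>A $ i $ j\<bar> \<le> C) \<longrightarrow> \<bar>det A\<bar> \<le> D"
    using abs_det_bounded ..
  have S: "S \<in> lmeasurable"
    using assms by (simp add: lmeasurable_open)
  show ?thesis
  proof (rule measurable_bounded_by_integrable_imp_absolutely_integrable)
    show "(\<lambda>x. det (jacobian F (at x))) \<in> borel_measurable (lebesgue_on S)"
      using S by (intro continuous_imp_measurable_on_sets_lebesgue continuous_on_det
          C1_closure_continuous_on_jacobian assms) auto
    show "(\<lambda>x. D) integrable_on S"
      using S by (rule integrable_on_const)
    show "norm (det (jacobian F (at x))) \<le> D" if "x \<in> S" for x
      using D C[OF that] by simp
  qed (use S in blast)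
qed

text \<open>The perturbation result is applied with \<open>u\<close> equal to \<open>F - G\<close>
  and with \<open>B\<close> the Jacobian of \<open>G\<close>.\<close>

lemma has_integral_det_jacobian_diff:
  fixes F G :: "real^'n \<Rightarrow> real^'n"
  assumes S: "open S" "bounded S" and F: "C1_closure S F" and G: "C1_closure S G"
    and eq: "\<And>x. x \<in> frontier S \<Longrightarrow> F x = G x"
  shows "((\<lambda>x. det (jacobian F (at x)) - det (jacobian G (at x))) has_integral 0) S"
proof -
  let ?DF = "\<lambda>x. jacobian F (at x)" and ?DG = "\<lambda>x. jacobian G (at x)"
  obtain CF where CF: "\<And>x i j. x \<in> S \<Longrightarrow> \<bar>?DF x $ i $ j\<bar> \<le> CF"
    by (rule C1_closure_bounded_jacobian[OF F S(2)]) (rule that)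
  obtain CG where CG: "\<And>x i j. x \<in> S \<Longrightarrow> \<bar>?DG x $ i $ j\<bar> \<le> CG"
    by (rule C1_closure_bounded_jacobian[OF G S(2)]) (rule that)
  have "((\<lambda>x. det (?DG x + (?DF x - ?DG x)) - det (?DG x)) has_integral 0) S"
  proof (rule has_integral_det_perturbation[OF S])
    show "continuous_on (closure S) (\<lambda>x. F x - G x)"
      using F G unfolding C1_closure_def by (intro continuous_on_diff) simp_all
    show "F x - G x = 0" if "x \<in> frontier S" for x
      using eq[OF that] by simp
    show "((\<lambda>x. F x - G x) has_derivative (\<lambda>h. (?DF x - ?DG x) *v h)) (at x)" if "x \<in> S" for x
      using has_derivative_diff[OF C1_closure_has_derivative[OF F that] C1_closure_has_derivative[OF G that]]
      by (simp add: matrix_vector_mult_diff_rdistrib)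
    show "continuous_on S (\<lambda>x. ?DF x - ?DG x)"
      by (intro continuous_on_diff C1_closure_continuous_on_jacobian F G)
    show "(G has_derivative (\<lambda>h. ?DG x *v h)) (at x)" if "x \<in> S" for x
      using G that by (rule C1_closure_has_derivative)
    show "continuous_on S ?DG"
      using G by (rule C1_closure_continuous_on_jacobian)
    \<comment> \<open>The absolute value of \<open>CF\<close> makes the sum at least
      \<open>CG\<close>, so the same constant also bounds the Jacobian of \<open>G\<close>.\<close>
    show "\<bar>(?DF x - ?DG x) $ i $ j\<bar> \<le> \<bar>CF\<bar> + CG" if "x \<in> S" for x i j
      using CF[OF that, of i j] CG[OF that, of i j] by (simp add: abs_le_iff)
    show "\<bar>?DG x $ i $ j\<bar> \<le> \<bar>CF\<bar> + CG" if "x \<in> S" for x i j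
      using CG[OF that, of i j] by simp
  qed
  then show ?thesis by simp
qed

theorem lemma1:
  fixes \<Omega> :: "(real ^ 'n) set" and F G :: "real ^ 'n \<Rightarrow> real ^ 'n"
  assumes "open \<Omega>" and "connected \<Omega>" and "bounded \<Omega>" and "C1_boundary \<Omega>"
    and "C1_closure \<Omega> F" and "C1_closure \<Omega> G"
    and "\<And>x. x \<in> frontier \<Omega> \<Longrightarrow> F x = G x"
  shows "(LINT x:\<Omega>|lebesgue. det (jacobian F (at x))) =
         (LINT x:\<Omega>|lebesgue. det (jacobian G (at x)))"
proof -
  \<comment> \<open>Absolute integrability of each determinant identifies the Lebesgue integrals
    with gauge integrals, whose difference is the integral of the difference.\<close>
  have F: "set_integrable lebesgue \<Omega> (\<lambda>x. det (jacobian F (at x)))"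
    and G: "set_integrable lebesgue \<Omega> (\<lambda>x. det (jacobian G (at x)))"
    using assms(1,3,5,6) set_integrable_det_jacobian by blast+
  have "(LINT x:\<Omega>|lebesgue. det (jacobian F (at x))) - (LINT x:\<Omega>|lebesgue. det (jacobian G (at x)))
      = integral \<Omega> (\<lambda>x. det (jacobian F (at x)) - det (jacobian G (at x)))"
    using set_lebesgue_integral_eq_integral[OF F] set_lebesgue_integral_eq_integral[OF G]
    by (simp add: integral_diff)
  also have "\<dots> = 0"
    using has_integral_det_jacobian_diff[OF assms(1,3,5,6,7)] by (rule integral_unique)
  finally show ?thesis by simp
qed

end
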